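(* Let $a<b$ be real numbers, let $n\ge 1$ be an integer, and let $a=x_0<x_1<\cdots<x_n=b$ and $a=y_0<y_1<\cdots<y_{n+1}=b$ be two partitions of $[a,b]$ such that $x_{i-1}\le y_i\le x_i$ for $i=1,2,\ldots,n$. If $f:[a,b]\to\mathbb{R}$ is convex on $[a,b]$, then $$\sum_{i=0}^{n}(y_{i+1}-y_i)f(x_i)+\sum_{i=0}^{n-1}(x_{i+1}-x_i)f(y_{i+1})\le \min\left\{\sum_{i=0}^{n}(y_{i+1}-y_i)\bigl(f(y_i)+f(y_{i+1})\bigr),\ \sum_{i=0}^{n-1}(x_{i+1}-x_i)\bigl(f(x_i)+f(x_{i+1})\bigr)\right\}.$$ *)

theory Defs
  imports "HOL-Analysis.Analysis"
begin

end

(* A piecewise chord estimate: if p i <= q i <= p (i + 1), the weighted chord inequality for f at q i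
   between the nodes p i and p (i + 1), summed over i, leaves exactly the term
   (q (i + 1) - q i) * f (p (i + 1)) at each interior node. Taking (p, q) = (y, x) bounds the left-hand
   side by the y-sum; taking p = x and q the shifted sequence y (i + 1) bounds it by the x-sum. *)
theory Submission
  imports Defs
begin

text \<open>The chord bound multiplied through by \<open>v - u\<close>. Without the denominator it
  survives the degenerate case \<open>u = v\<close>, where both sides are 0.\<close>

lemma convex_on_chord_weighted:
  fixes f :: "real \<Rightarrow> real"
  assumes "convex_on {u..v} f" "u \<le> c" "c \<le> v"
  shows "(v - u) * f c \<le> (v - c) * f u + (c - u) * f v"
proof (cases "u = v")
  case False
  then have "u < v" using assms by simp
  have "f c \<le> (f v - f u) / (v - u) * (c - u) + f u"
    using convex_onD_Icc'[OF assms(1)] assms by simp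
  then have "(v - u) * f c \<le> (v - u) * ((f v - f u) / (v - u) * (c - u) + f u)"
    using \<open>u < v\<close> by (intro mult_left_mono) auto
  also have "\<dots> = (f v - f u) * (c - u) + (v - u) * f u"
    using \<open>u < v\<close> by (simp add: distrib_left)
  finally show ?thesis by (simp add: algebra_simps)
qed (use assms in simp)

text \<open>No endpoint of \<open>p\<close> is tied to an endpoint of \<open>q\<close>, so two
  boundary terms remain. They vanish when the endpoints coincide; for a shifted \<open>q\<close>
  they supply the first and last summands of the other sum.\<close>

lemma convex_on_interlacing_sum_le:
  fixes f :: "real \<Rightarrow> real" and p q :: "nat \<Rightarrow> real"
  assumes "\<And>i. i \<le> m \<Longrightarrow> convex_on {p i..p (Suc i)} f"
    and "\<And>i. i \<le> m \<Longrightarrow> p i \<le> q i \<and> q i \<le> p (Suc i)"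
  shows "(\<Sum>i\<le>m. (p (Suc i) - p i) * f (q i)) + (\<Sum>i<m. (q (Suc i) - q i) * f (p (Suc i)))
      + (q 0 - p 0) * f (p 0) + (p (Suc m) - q m) * f (p (Suc m))
    \<le> (\<Sum>i\<le>m. (p (Suc i) - p i) * (f (p i) + f (p (Suc i))))"
  using assms
proof (induction m)
  case 0
  then show ?case
    using convex_on_chord_weighted[of "p 0" "p (Suc 0)" f "q 0"] by (simp add: algebra_simps)
next
  case (Suc m)
  \<comment> \<open>This is exactly the increment of the claim from \<open>m\<close> to
    \<open>Suc m\<close>: the old boundary weight \<open>p (Suc m) - q m\<close> at
    \<open>p (Suc m)\<close> is replaced by the interior weight
    \<open>q (Suc m) - q m\<close>.\<close>
  then have "(p (Suc (Suc m)) - p (Suc m)) * f (q (Suc m))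
      \<le> (p (Suc (Suc m)) - q (Suc m)) * f (p (Suc m)) + (q (Suc m) - p (Suc m)) * f (p (Suc (Suc m)))"
    by (intro convex_on_chord_weighted) auto
  with Suc show ?case by (simp add: algebra_simps)
qed

lemma le_of_le_steps:
  fixes p :: "nat \<Rightarrow> 'a :: order"
  assumes "\<And>i. i < n \<Longrightarrow> p i \<le> p (Suc i)" "j \<le> k" "k \<le> n"
  shows "p j \<le> p k"
  using assms(2,3)
proof (induction k rule: dec_induct)
  case (step k)
  then show ?case using assms(1)[of k] by auto
qed simp

theorem mainTheorem2:
  fixes a b :: real and n :: nat and x y :: "nat \<Rightarrow> real" and f :: "real \<Rightarrow> real"
  assumes "a < b"
    and "n \<ge> 1"
    and "x 0 = a" and "\<And>i. i < n \<Longrightarrow> x i < x (i + 1)" and "x n = b"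
    and "y 0 = a" and "\<And>i. i < n + 1 \<Longrightarrow> y i < y (i + 1)" and "y (n + 1) = b"
    and "\<And>i. i \<in> {1..n} \<Longrightarrow> x (i - 1) \<le> y i \<and> y i \<le> x i"
    and "convex_on {a..b} f"
  shows "(\<Sum>i=0..n. (y (i + 1) - y i) * f (x i)) + (\<Sum>i=0..n - 1. (x (i + 1) - x i) * f (y (i + 1)))
    \<le> min (\<Sum>i=0..n. (y (i + 1) - y i) * (f (y i) + f (y (i + 1))))
          (\<Sum>i=0..n - 1. (x (i + 1) - x i) * (f (x i) + f (x (i + 1))))"
proof -
  obtain m where m: "n = Suc m"
    using \<open>n \<ge> 1\<close> by (cases n) auto
  note xlt = assms(4) and ylt = assms(7) and inter = assms(9)
  have x_sub: "{x i..x (Suc i)} \<subseteq> {a..b}" if "i \<le> m" for i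
    using le_of_le_steps[of n x 0 i] le_of_le_steps[of n x "Suc i" n] that xlt
    by (force simp: m less_imp_le \<open>x 0 = a\<close> \<open>x n = b\<close>[symmetric])
  have y_sub: "{y i..y (Suc i)} \<subseteq> {a..b}" if "i \<le> n" for i
    using le_of_le_steps[of "n + 1" y 0 i] le_of_le_steps[of "n + 1" y "Suc i" "n + 1"] that ylt
    by (force simp: less_imp_le \<open>y 0 = a\<close> \<open>y (n + 1) = b\<close>[symmetric])
  have x_cvx: "convex_on {x i..x (Suc i)} f" if "i \<le> m" for i
    using convex_on_subset[OF assms(10)] x_sub[OF that] by auto
  have y_cvx: "convex_on {y i..y (Suc i)} f" if "i \<le> n" for i
    using convex_on_subset[OF assms(10)] y_sub[OF that] by auto
  have y_in: "x i \<le> y (Suc i) \<and> y (Suc i) \<le> x (Suc i)" if "i \<le> m" for i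
    using inter[of "Suc i"] that m by auto
  \<comment> \<open>Interlacing at \<open>i\<close> and at \<open>Suc i\<close> gives the two
    bounds; the cases it misses, \<open>i = 0\<close> and \<open>i = n\<close>, come from the common
    endpoints.\<close>
  have x_in: "y i \<le> x i \<and> x i \<le> y (Suc i)" if "i \<le> n" for i
  proof
    show "y i \<le> x i"
      using inter[of i] that assms(3,6) by (cases "i = 0") auto
    show "x i \<le> y (Suc i)"
      using inter[of "Suc i"] that assms(5,8) by (cases "i = n") auto
  qed
  let ?L = "(\<Sum>i\<le>n. (y (Suc i) - y i) * f (x i)) + (\<Sum>i<n. (x (Suc i) - x i) * f (y (Suc i)))"
  \<comment> \<open>Both boundary terms are 0, as \<open>x 0 = y 0\<close> and
    \<open>x n = y (n + 1)\<close>.\<close>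
  have "?L \<le> (\<Sum>i\<le>n. (y (Suc i) - y i) * (f (y i) + f (y (Suc i))))"
    using convex_on_interlacing_sum_le[of n y f x, OF y_cvx x_in] assms(3,5,6,8) by simp
  moreover have "?L \<le> (\<Sum>i<n. (x (Suc i) - x i) * (f (x i) + f (x (Suc i))))"
  proof -
    \<comment> \<open>Split off the summands \<open>i = 0\<close> and \<open>i = n\<close>;
      rewriting \<open>y 0\<close> as \<open>x 0\<close> and \<open>y (n + 1)\<close> as
      \<open>x n\<close> turns them into the boundary terms for nodes \<open>x\<close> and points
      \<open>y (Suc i)\<close>.\<close>
    have "(\<Sum>i\<le>n. (y (Suc i) - y i) * f (x i))
        = (\<Sum>i<m. (y (Suc (Suc i)) - y (Suc i)) * f (x (Suc i)))
          + (y (Suc 0) - x 0) * f (x 0) + (x n - y n) * f (x n)"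
      using assms(3,5,6,8) unfolding m by (simp add: sum.atMost_shift)
    then show ?thesis
      using convex_on_interlacing_sum_le[of m x f "\<lambda>i. y (Suc i)", OF x_cvx y_in]
      by (simp add: m lessThan_Suc_atMost)
  qed
  \<comment> \<open>Subtraction on naturals truncates, so this relies on \<open>n\<close> being
    positive.\<close>
  moreover have "{0..n - 1} = {..<n}"
    using m by auto
  ultimately show ?thesis
    by (simp add: atLeast0AtMost)
qed

end
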